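(* Let $\{X(s,t):s,t\in\mathbb{R}\}$ be a stationary Ornstein-Uhlenbeck field with parameters $(\frac12,\frac12,1)$. There do not exist functions $f,g:(0,1]\to(0,\infty)$ such that $f$ is monotone and the random field $\{V(s,t):(s,t)\in[0,1]^2\}$ defined by $$V(s,t):=\begin{cases}\sqrt{g(s)g(t)}\;X\big(\ln(f(s)),\ln(f(t))\big) & \text{if } (s,t)\in(0,1]^2,\\ 0 & \text{if } s=0\text{ or } t=0,\end{cases}$$ generates the same law on $C([0,1]^2)$ as a bivariate Wiener bridge $B$.
   Context: A random field $\{Y(s,t):(s,t)\in D\}$, $D\subseteq\mathbb{R}^2$, is a Gauss field if all its finite-dimensional distributions are (possibly degenerate) multivariate normal. It has continuous sample paths almost surely if $\mathbb{P}(\{\omega: D\ni(s,t)\mapsto Y(s,t)(\omega)\text{ is continuous}\})=1$. $C(D)$ is the space of continuous real-valued functions on $D$. Two fields generate the same law on $C(D)$ if both have continuous sample paths almost surely and the induced probability laws on $C(D)$ coincide. A standard Wiener field is a zero-mean Gauss field $\{W(s,t):s,t\in[0,\infty)\}$ with continuous sample paths almost surely and $\operatorname{Cov}(W(s_1,t_1),W(s_2,t_2))=\min(s_1,s_2)\min(t_1,t_2)$. A stationary Ornstein-Uhlenbeck field with parameters $(\frac12,\frac12,1)$ is a zero-mean Gauss field $\{X(s,t):s,t\in\mathbb{R}\}$ with continuous sample paths almost surely and $\operatorname{Cov}(X(s_1,t_1),X(s_2,t_2))=\exp\{-\frac12|s_2-s_1|-\frac12|t_2-t_1|\}$. A bivariate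 Wiener bridge is the field $B(s,t):=W(s,t)-stW(1,1)$, $s,t\in[0,1]$, where $W$ is a standard Wiener field; it is a zero-mean Gauss field with continuous sample paths almost surely and covariance function $\operatorname{Cov}(B(s_1,t_1),B(s_2,t_2))=\min(s_1,s_2)\min(t_1,t_2)-s_1s_2t_1t_2$. *)

theory Defs
  imports "HOL-Probability.Probability"
begin

type_synonym 'w field = "real \<times> real \<Rightarrow> 'w \<Rightarrow> real"

definition random_field :: "'w measure \<Rightarrow> (real \<times> real) set \<Rightarrow> 'w field \<Rightarrow> bool" where
  "random_field M D Y \<longleftrightarrow> prob_space M \<and> (\<forall>p\<in>D. Y p \<in> borel_measurable M)"

definition normal_law :: "real \<Rightarrow> real \<Rightarrow> real measure" where
  "normal_law \<mu> \<sigma> =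
     (if \<sigma> = 0 then return borel \<mu> else density lborel (\<lambda>x. ennreal (normal_density \<mu> \<sigma> x)))"

(* A random vector (Y_i), i in I, is (possibly degenerate) multivariate normal if all its
   linear combinations are normal, point masses being allowed. *)
definition multivariate_normal ::
    "'w measure \<Rightarrow> 'i set \<Rightarrow> ('i \<Rightarrow> 'w \<Rightarrow> real) \<Rightarrow> bool" where
  "multivariate_normal M I Y \<longleftrightarrow>
     (\<forall>i\<in>I. Y i \<in> borel_measurable M) \<and>
     (\<forall>c :: 'i \<Rightarrow> real. \<exists>\<mu> \<sigma>. 0 \<le> \<sigma> \<and>
        distr M borel (\<lambda>\<omega>. \<Sum>i\<in>I. c i * Y i \<omega>) = normal_law \<mu> \<sigma>)"

definition gauss_field :: "'w measure \<Rightarrow> (real \<times> real) set \<Rightarrow> 'w field \<Rightarrow> bool" where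
  "gauss_field M D Y \<longleftrightarrow>
     random_field M D Y \<and> (\<forall>I. finite I \<and> I \<subseteq> D \<longrightarrow> multivariate_normal M I Y)"

definition zero_mean :: "'w measure \<Rightarrow> (real \<times> real) set \<Rightarrow> 'w field \<Rightarrow> bool" where
  "zero_mean M D Y \<longleftrightarrow> (\<forall>p\<in>D. integral\<^sup>L M (Y p) = 0)"

definition covariance :: "'w measure \<Rightarrow> ('w \<Rightarrow> real) \<Rightarrow> ('w \<Rightarrow> real) \<Rightarrow> real" where
  "covariance M Y Z =
     integral\<^sup>L M (\<lambda>\<omega>. (Y \<omega> - integral\<^sup>L M Y) * (Z \<omega> - integral\<^sup>L M Z))"

(* The set of outcomes with a continuous path need not be measurable; AE gives it
   probability 1 with respect to the completion of M. *)
definition continuous_paths_as :: "'w measure \<Rightarrow> (real \<times> real) set \<Rightarrow> 'w field \<Rightarrow> bool" where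
  "continuous_paths_as M D Y \<longleftrightarrow> (AE \<omega> in M. continuous_on D (\<lambda>p. Y p \<omega>))"

definition standard_wiener_field :: "'w measure \<Rightarrow> 'w field \<Rightarrow> bool" where
  "standard_wiener_field M W \<longleftrightarrow>
     gauss_field M ({0..} \<times> {0..}) W \<and>
     zero_mean M ({0..} \<times> {0..}) W \<and>
     continuous_paths_as M ({0..} \<times> {0..}) W \<and>
     (\<forall>s\<^sub>1\<ge>0. \<forall>t\<^sub>1\<ge>0. \<forall>s\<^sub>2\<ge>0. \<forall>t\<^sub>2\<ge>0.
        covariance M (W (s\<^sub>1, t\<^sub>1)) (W (s\<^sub>2, t\<^sub>2)) = min s\<^sub>1 s\<^sub>2 * min t\<^sub>1 t\<^sub>2)"

(* parameters (1/2, 1/2, 1) *)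
definition stationary_OU_field :: "'w measure \<Rightarrow> 'w field \<Rightarrow> bool" where
  "stationary_OU_field M X \<longleftrightarrow>
     gauss_field M UNIV X \<and>
     zero_mean M UNIV X \<and>
     continuous_paths_as M UNIV X \<and>
     (\<forall>s\<^sub>1 t\<^sub>1 s\<^sub>2 t\<^sub>2.
        covariance M (X (s\<^sub>1, t\<^sub>1)) (X (s\<^sub>2, t\<^sub>2)) =
          exp (- (1/2) * \<bar>s\<^sub>2 - s\<^sub>1\<bar> - (1/2) * \<bar>t\<^sub>2 - t\<^sub>1\<bar>))"

(* only the values on {0..1} \<times> {0..1} are meaningful *)
definition wiener_bridge :: "'w field \<Rightarrow> 'w field" where
  "wiener_bridge W = (\<lambda>(s, t) \<omega>. W (s, t) \<omega> - s * t * W (1, 1) \<omega>)"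

(* C(D), a function on D being represented by its extension with value undefined off D *)
definition C_space :: "(real \<times> real) set \<Rightarrow> (real \<times> real \<Rightarrow> real) set" where
  "C_space D = {h \<in> extensional D. continuous_on D h}"

(* C(D) with the sigma-algebra generated by the point evaluations. For compact D, in
   particular the unit square, this is the Borel sigma-algebra of the supremum norm. *)
definition C_measurable :: "(real \<times> real) set \<Rightarrow> (real \<times> real \<Rightarrow> real) measure" where
  "C_measurable D = restrict_space (Pi\<^sub>M D (\<lambda>_. borel)) (C_space D)"

definition path :: "(real \<times> real) set \<Rightarrow> 'w field \<Rightarrow> 'w \<Rightarrow> real \<times> real \<Rightarrow> real" where
  "path D Y \<omega> =
     (if continuous_on D (\<lambda>p. Y p \<omega>) then restrict (\<lambda>p. Y p \<omega>) D else restrict (\<lambda>_. 0) D)"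

(* The completion makes path measurable even if the exceptional set, on which the path is
   replaced by 0, is only contained in a null set; see measurable_path. *)
definition law_on_C :: "'w measure \<Rightarrow> (real \<times> real) set \<Rightarrow> 'w field \<Rightarrow>
    (real \<times> real \<Rightarrow> real) measure" where
  "law_on_C M D Y = distr (completion M) (C_measurable D) (path D Y)"

lemma measurable_path:
  assumes "random_field M D Y" and "continuous_paths_as M D Y"
  shows "path D Y \<in> completion M \<rightarrow>\<^sub>M C_measurable D"
proof -
  have c: "Measurable.pred (completion M) (\<lambda>\<omega>. continuous_on D (\<lambda>p. Y p \<omega>))"
  proof -
    have "Measurable.pred (completion M) (\<lambda>\<omega>. \<not> continuous_on D (\<lambda>p. Y p \<omega>))"
      using assms(2) by (intro sets_completion_AE) (simp add: continuous_paths_as_def)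
    from pred_intros_logic(2)[OF this] show ?thesis by simp
  qed
  have y: "Y p \<in> borel_measurable (completion M)" if "p \<in> D" for p
    using assms(1) that by (intro measurable_completion) (simp add: random_field_def)
  have *: "path D Y = (\<lambda>\<omega>. \<lambda>p\<in>D. if continuous_on D (\<lambda>p. Y p \<omega>) then Y p \<omega> else 0)"
    by (auto simp: path_def fun_eq_iff)
  have "path D Y \<in> completion M \<rightarrow>\<^sub>M Pi\<^sub>M D (\<lambda>_. borel)"
    unfolding * by (intro measurable_restrict measurable_If y measurable_const c[unfolded pred_def]) auto
  moreover have "path D Y \<omega> \<in> C_space D" for \<omega>
    by (auto simp: path_def C_space_def cong: continuous_on_cong)
  ultimately show ?thesis
    unfolding C_measurable_def by (intro measurable_restrict_space2) auto
qed

definition same_law_on_C :: "(real \<times> real) set \<Rightarrow> 'v measure \<Rightarrow> 'v field \<Rightarrow>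
    'w measure \<Rightarrow> 'w field \<Rightarrow> bool" where
  "same_law_on_C D M Y N Z \<longleftrightarrow>
     random_field M D Y \<and> continuous_paths_as M D Y \<and>
     random_field N D Z \<and> continuous_paths_as N D Z \<and>
     law_on_C M D Y = law_on_C N D Z"

end

theory Submission
  imports Defs
begin

text \<open>
  The obstruction sits at the corner \<open>(1, 1)\<close>. There the bridge is pinned: it equals
  \<open>W (1, 1) - W (1, 1) = 0\<close>. Equality of laws on the path space transfers almost sure
  statements about the value at a point, so the transformed Ornstein-Uhlenbeck field would
  also vanish almost surely at \<open>(1, 1)\<close>. Its value there is, however, \<open>g 1 > 0\<close> times a
  variable of the stationary field, which has variance \<open>1\<close> at every point of the plane.
\<close>

text \<open>
  The path coincides with the field only off a null set, and it is measurable only with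
  respect to the completion; neither affects almost sure statements. An almost sure statement
  about the value at \<open>p\<close> can therefore be read off from the law, because evaluation at \<open>p\<close> is
  measurable on the path space.
\<close>
lemma AE_law_on_C_iff:
  assumes rf: "random_field M D Y" and cp: "continuous_paths_as M D Y" and p: "p \<in> D"
    and P: "Measurable.pred borel P"
  shows "(AE h in law_on_C M D Y. P (h p)) \<longleftrightarrow> (AE \<omega> in M. P (Y p \<omega>))"
proof -
  have ev: "(\<lambda>h. h p) \<in> borel_measurable (C_measurable D)"
    unfolding C_measurable_def
    by (intro measurable_restrict_space1 measurable_component_singleton p)
  have "(AE h in law_on_C M D Y. P (h p)) \<longleftrightarrow> (AE \<omega> in completion M. P (path D Y \<omega> p))"
    unfolding law_on_C_def
    by (intro AE_distr_iff measurable_path[OF rf cp] measurable_compose[OF ev P, unfolded pred_def])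
  also have "\<dots> \<longleftrightarrow> (AE \<omega> in M. P (path D Y \<omega> p))"
    by (rule AE_completion_iff)
  also have "\<dots> \<longleftrightarrow> (AE \<omega> in M. P (Y p \<omega>))"
  proof (rule eventually_subst)
    show "AE \<omega> in M. P (path D Y \<omega> p) \<longleftrightarrow> P (Y p \<omega>)"
      using cp[unfolded continuous_paths_as_def]
      by (rule eventually_mono) (simp add: path_def p)
  qed
  finally show ?thesis .
qed

lemma same_law_on_C_AE_iff:
  assumes "same_law_on_C D M Y N Z" and "p \<in> D" and "Measurable.pred borel P"
  shows "(AE \<omega> in M. P (Y p \<omega>)) \<longleftrightarrow> (AE \<omega> in N. P (Z p \<omega>))"
proof -
  have "(AE \<omega> in M. P (Y p \<omega>)) \<longleftrightarrow> (AE h in law_on_C M D Y. P (h p))"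
    using assms by (intro AE_law_on_C_iff[symmetric]) (simp_all add: same_law_on_C_def)
  also have "law_on_C M D Y = law_on_C N D Z"
    using assms(1) by (simp add: same_law_on_C_def)
  also have "(AE h in law_on_C N D Z. P (h p)) \<longleftrightarrow> (AE \<omega> in N. P (Z p \<omega>))"
    using assms by (intro AE_law_on_C_iff) (simp_all add: same_law_on_C_def)
  finally show ?thesis .
qed

lemma covariance_AE_eq_0:
  assumes "AE \<omega> in M. Y \<omega> = 0"
  shows "covariance M Y Y = 0"
proof -
  have "integral\<^sup>L M Y = 0"
    using assms by (rule integral_eq_zero_AE)
  then show ?thesis
    unfolding covariance_def using assms by (intro integral_eq_zero_AE) auto
qed

text \<open>
  At \<open>(1, 1)\<close> the scaling is \<open>sqrt (g 1 * g 1)\<close>, which is nonzero. Vanishing of the scaled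
  field there therefore forces a variable of the stationary field to vanish almost surely,
  against its variance \<open>1\<close>.
\<close>
lemma scaled_OU_field_not_wiener_bridge:
  assumes OU: "stationary_OU_field M X" and g1: "g 1 > 0"
  shows "\<not> same_law_on_C ({0..1} \<times> {0..1})
        M (\<lambda>(s, t) \<omega>.
             if s \<in> {0<..1} \<and> t \<in> {0<..1}
             then sqrt (g s * g t) * X (ln (f s), ln (f t)) \<omega>
             else 0)
        N (wiener_bridge W)" (is "\<not> same_law_on_C ?D M ?V N _")
proof
  assume law: "same_law_on_C ?D M ?V N (wiener_bridge W)"
  have "AE \<omega> in N. wiener_bridge W (1, 1) \<omega> = 0"
    by (simp add: wiener_bridge_def)
  then have "AE \<omega> in M. ?V (1, 1) \<omega> = 0"
    using same_law_on_C_AE_iff[OF law, of "(1, 1)" "\<lambda>x. x = 0"] by simp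
  then have "AE \<omega> in M. X (ln (f 1), ln (f 1)) \<omega> = 0"
    using g1 by simp
  then have "covariance M (X (ln (f 1), ln (f 1))) (X (ln (f 1), ln (f 1))) = 0"
    by (rule covariance_AE_eq_0)
  moreover have "covariance M (X (ln (f 1), ln (f 1))) (X (ln (f 1), ln (f 1))) = 1"
    using OU by (simp add: stationary_OU_field_def)
  ultimately show False
    by simp
qed

theorem mainTheorem2:
  fixes M :: "'a measure" and X :: "'a field"
    and N :: "'b measure" and W :: "'b field"
  assumes "stationary_OU_field M X"
    and "standard_wiener_field N W"
  shows "\<not> (\<exists>f g :: real \<Rightarrow> real.
      f ` {0<..1} \<subseteq> {0<..} \<and> g ` {0<..1} \<subseteq> {0<..} \<and>
      (mono_on {0<..1} f \<or> antimono_on {0<..1} f) \<and>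
      same_law_on_C ({0..1} \<times> {0..1})
        M (\<lambda>(s, t) \<omega>.
             if s \<in> {0<..1} \<and> t \<in> {0<..1}
             then sqrt (g s * g t) * X (ln (f s), ln (f t)) \<omega>
             else 0)
        N (wiener_bridge W))"
proof (rule notI, elim exE conjE)
  fix f g :: "real \<Rightarrow> real"
  assume "g ` {0<..1} \<subseteq> {0<..}"
  then have g1: "g 1 > 0"
    by (simp add: image_subset_iff)
  assume law: "same_law_on_C ({0..1} \<times> {0..1})
        M (\<lambda>(s, t) \<omega>.
             if s \<in> {0<..1} \<and> t \<in> {0<..1}
             then sqrt (g s * g t) * X (ln (f s), ln (f t)) \<omega>
             else 0)
        N (wiener_bridge W)"
  show False
    by (rule notE[OF scaled_OU_field_not_wiener_bridge[where g = g, OF assms(1) g1] law])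
qed

end
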